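(* Let $0<\mu<L$ and $\kappa=L/\mu$. Let $\nu\in(-2/L,0)$ and let $\ell(\lambda,\eta)=\lambda-\eta a_0-b_0$ with $a_0,b_0\in\mathbb{R}$ satisfy $\ell(1,\eta)=-\nu\eta$ for all $\eta\in[\mu,L]$. Then $a_0=\nu$ and $b_0=1$, and $\rho_\lambda(\ell(\lambda,\eta))<1$ for all $\eta\in[\mu,L]$; the corresponding 1-SCLI algorithm is $\mathbf{x}^{k+1}=(I+\nu A)\mathbf{x}^k+\nu\mathbf{b}$. Moreover, among all such $\nu$ the quantity $\max_{\eta\in[\mu,L]}\rho_\lambda(\ell(\lambda,\eta))$ has minimum value $$\frac{\kappa-1}{\kappa+1},$$ attained at $\nu=\frac{-2}{\mu+L}$, i.e. by Full Gradient Descent; that is, Full Gradient Descent is optimal in the class of 1-SCLI algorithms with linear coefficient matrices.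
   Context: For a polynomial in $\lambda$, $\rho_\lambda$ denotes the maximum modulus of its roots (so here $\rho_\lambda(\ell(\lambda,\eta))=|\eta a_0+b_0|$). A deterministic 1-SCLI algorithm with linear coefficient matrix and scalar inversion matrix $\nu I_d$, for minimizing $f_{A,\mathbf{b}}(\mathbf{x})=\frac12\mathbf{x}^\top A\mathbf{x}+\mathbf{b}^\top\mathbf{x}$ with $A$ real symmetric with spectrum in $[\mu,L]$, is an iteration $\mathbf{x}^{k+1}=(a_0A+b_0I_d)\mathbf{x}^k+\nu\mathbf{b}$; the associated polynomial is $\ell(\lambda,\eta)=\lambda-\eta a_0-b_0$, where $\eta$ ranges over the possible eigenvalues of $A$. The condition $\ell(1,\eta)=-\nu\eta$ together with $\rho_\lambda(\ell(\lambda,\eta))<1$ for $\eta\in[\mu,L]$ is the requirement that the iteration converge to the minimizer $-A^{-1}\mathbf{b}$ for all such $A$, $\mathbf{b}$ and starting points. Full Gradient Descent is the iteration $\mathbf{x}^{k+1}=\mathbf{x}^k-\beta\nabla f(\mathbf{x}^k)$ with $\beta=\frac{2}{\mu+L}$. *)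

theory Defs
  imports "HOL-Analysis.Analysis" "HOL-Computational_Algebra.Polynomial"
begin

(* Roots are taken in the complex numbers; Max is meaningful for nonconstant p only. *)
definition root_radius :: "real poly \<Rightarrow> real" where
  "root_radius p = Max (cmod ` {z. poly (map_poly complex_of_real p) z = 0})"

(* The polynomial lambda - eta * a0 - b0 in the indeterminate lambda. *)
definition ell :: "real \<Rightarrow> real \<Rightarrow> real \<Rightarrow> real poly" where
  "ell a0 b0 \<eta> = [:- (\<eta> * a0) - b0, 1:]"

definition consistent :: "real \<Rightarrow> real \<Rightarrow> real \<Rightarrow> real \<Rightarrow> real \<Rightarrow> bool" where
  "consistent \<mu> L a0 b0 \<nu> \<longleftrightarrow> (\<forall>\<eta>\<in>{\<mu>..L}. poly (ell a0 b0 \<eta>) 1 = - \<nu> * \<eta>)"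

(* A 1-SCLI algorithm with linear coefficient matrix a0 A + b0 I and inversion matrix nu I
   is given by the triple (a0, b0, nu). *)
definition linear_scli :: "real \<Rightarrow> real \<Rightarrow> (real \<times> real \<times> real) set" where
  "linear_scli \<mu> L =
     {(a0, b0, \<nu>). consistent \<mu> L a0 b0 \<nu> \<and> (\<forall>\<eta>\<in>{\<mu>..L}. root_radius (ell a0 b0 \<eta>) < 1)}"

definition worst_radius :: "real \<Rightarrow> real \<Rightarrow> real \<times> real \<times> real \<Rightarrow> real" where
  "worst_radius \<mu> L = (\<lambda>(a0, b0, \<nu>). SUP \<eta>\<in>{\<mu>..L}. root_radius (ell a0 b0 \<eta>))"

definition quadratic :: "real^'n^'n \<Rightarrow> real^'n \<Rightarrow> real^'n \<Rightarrow> real" where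
  "quadratic A b x = 1 / 2 * (x \<bullet> (A *v x)) + b \<bullet> x"

(* All eigenvalues of a real symmetric matrix are real, so real eigenvectors suffice. *)
definition symmetric_spectrum_in :: "real^'n^'n \<Rightarrow> real set \<Rightarrow> bool" where
  "symmetric_spectrum_in A S \<longleftrightarrow>
     transpose A = A \<and> {\<eta>. \<exists>v. v \<noteq> 0 \<and> A *v v = \<eta> *\<^sub>R v} \<subseteq> S"

definition scli_iteration ::
  "real \<times> real \<times> real \<Rightarrow> real^'n^'n \<Rightarrow> real^'n \<Rightarrow> (nat \<Rightarrow> real^'n) \<Rightarrow> bool" where
  "scli_iteration = (\<lambda>(a0, b0, \<nu>) A b x.
     \<forall>k. x (Suc k) = (a0 *\<^sub>R A + b0 *\<^sub>R mat 1) *v x k + \<nu> *\<^sub>R b)"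

definition gradient_descent ::
  "real \<Rightarrow> ('a::real_inner \<Rightarrow> real) \<Rightarrow> (nat \<Rightarrow> 'a) \<Rightarrow> bool" where
  "gradient_descent \<beta> f x \<longleftrightarrow>
     (\<forall>k. \<exists>g. (GDERIV f (x k) :> g) \<and> x (Suc k) = x k - \<beta> *\<^sub>R g)"

definition full_gradient_descent ::
  "real \<Rightarrow> real \<Rightarrow> ('a::real_inner \<Rightarrow> real) \<Rightarrow> (nat \<Rightarrow> 'a) \<Rightarrow> bool" where
  "full_gradient_descent \<mu> L = gradient_descent (2 / (\<mu> + L))"

end

(*
  Consistency forces a0 = \<nu> and b0 = 1, so the spectral radius at \<eta> is |1 + \<nu> \<eta>|.  The lower
  bound is the triangle inequality L |1 + \<nu> \<mu>| + \<mu> |1 + \<nu> L| \<ge> L - \<mu>, whose left side is at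
  most L + \<mu> times the worst radius.  At \<nu> = -2 / (\<mu> + L) the quantities 1 + \<nu> \<mu> and 1 + \<nu> L
  are opposite, and the bound is attained at both endpoints.
*)
theory Submission
  imports Defs
begin

text \<open>The polynomial is monic of degree one, so \<open>Max\<close> runs over a singleton and
  the radius is the modulus of its only root.\<close>

lemma root_radius_ell: "root_radius (ell a0 b0 \<eta>) = \<bar>\<eta> * a0 + b0\<bar>"
proof -
  have "{z. poly (map_poly complex_of_real (ell a0 b0 \<eta>)) z = 0} = {complex_of_real (\<eta> * a0 + b0)}"
    by (auto simp: ell_def map_poly_pCons algebra_simps)
  then show ?thesis
    unfolding root_radius_def by (simp only: image_insert image_empty Max_singleton norm_of_real)
qed

lemma consistent_iff:
  assumes "\<mu> < L"
  shows "consistent \<mu> L a0 b0 \<nu> \<longleftrightarrow> a0 = \<nu> \<and> b0 = 1"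
proof
  assume "consistent \<mu> L a0 b0 \<nu>"
  then have eq: "1 - \<eta> * a0 - b0 = - \<nu> * \<eta>" if "\<eta> \<in> {\<mu>..L}" for \<eta>
    using that by (force simp: consistent_def ell_def)
  \<comment> \<open>The consistency equation is affine in \<eta>. Subtracting its instances at the
    two endpoints eliminates \<open>b0\<close>, and L - \<mu> is nonzero.\<close>
  have "(L - \<mu>) * (a0 - \<nu>) = 0"
    using eq[of \<mu>] eq[of L] assms by (simp add: algebra_simps)
  then have "a0 = \<nu>"
    using assms by simp
  then show "a0 = \<nu> \<and> b0 = 1"
    using eq[of L] assms by (simp add: algebra_simps)
qed (simp add: consistent_def ell_def)

text \<open>The radius is continuous in \<eta> on a compact interval, so the supremum in
  \<open>worst_radius\<close> is a genuine maximum and bounds the radius at each \<eta>.\<close>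

lemma worst_radius_attained:
  assumes "\<mu> \<le> L"
  shows "\<exists>\<eta>\<in>{\<mu>..L}. root_radius (ell a0 b0 \<eta>) = worst_radius \<mu> L (a0, b0, \<nu>)"
    and "\<forall>\<eta>\<in>{\<mu>..L}. root_radius (ell a0 b0 \<eta>) \<le> worst_radius \<mu> L (a0, b0, \<nu>)"
proof -
  have "continuous_on {\<mu>..L} (\<lambda>\<eta>. \<bar>\<eta> * a0 + b0\<bar>)"
    by (intro continuous_intros)
  from continuous_attains_sup[OF compact_Icc _ this] assms
  obtain m where m: "m \<in> {\<mu>..L}" "\<And>\<eta>. \<eta> \<in> {\<mu>..L} \<Longrightarrow> \<bar>\<eta> * a0 + b0\<bar> \<le> \<bar>m * a0 + b0\<bar>"
    by auto
  have w: "worst_radius \<mu> L (a0, b0, \<nu>) = \<bar>m * a0 + b0\<bar>"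
    unfolding worst_radius_def root_radius_ell prod.case
    by (rule cSup_eq_maximum) (use m in auto)
  then show "\<exists>\<eta>\<in>{\<mu>..L}. root_radius (ell a0 b0 \<eta>) = worst_radius \<mu> L (a0, b0, \<nu>)"
    and "\<forall>\<eta>\<in>{\<mu>..L}. root_radius (ell a0 b0 \<eta>) \<le> worst_radius \<mu> L (a0, b0, \<nu>)"
    unfolding root_radius_ell w using m by blast+
qed

lemma worst_radius_lower_bound:
  assumes "0 < \<mu>" "\<mu> < L"
  shows "(L - \<mu>) / (L + \<mu>) \<le> worst_radius \<mu> L (\<nu>, 1, \<nu>)"
proof -
  let ?w = "worst_radius \<mu> L (\<nu>, 1, \<nu>)"
  have \<mu>: "\<bar>\<mu> * \<nu> + 1\<bar> \<le> ?w" and L: "\<bar>L * \<nu> + 1\<bar> \<le> ?w"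
    using worst_radius_attained(2)[of \<mu> L \<nu> 1 \<nu>] assms by (auto simp: root_radius_ell)
  \<comment> \<open>The weights L and \<mu> make the terms in \<nu> cancel, so the resulting bound
    holds uniformly in \<nu>.\<close>
  have "L - \<mu> = L * (\<mu> * \<nu> + 1) + \<mu> * - (L * \<nu> + 1)"
    by (simp add: algebra_simps)
  also have "\<dots> \<le> L * ?w + \<mu> * ?w"
    using \<mu> L assms by (intro add_mono mult_left_mono) auto
  finally show ?thesis
    using assms by (simp add: field_simps)
qed

lemma worst_radius_full_gradient_descent:
  assumes "0 < \<mu>" "\<mu> < L"
  shows "worst_radius \<mu> L (-2 / (\<mu> + L), 1, -2 / (\<mu> + L)) = (L - \<mu>) / (L + \<mu>)"
proof (rule antisym)
  obtain \<eta> where \<eta>: "\<eta> \<in> {\<mu>..L}"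
    "worst_radius \<mu> L (-2 / (\<mu> + L), 1, -2 / (\<mu> + L)) = \<bar>\<eta> * (-2 / (\<mu> + L)) + 1\<bar>"
    using worst_radius_attained(1)[of \<mu> L] assms unfolding root_radius_ell by (metis less_imp_le)
  have "\<eta> * (-2 / (\<mu> + L)) + 1 = (\<mu> + L - 2 * \<eta>) / (L + \<mu>)"
    using assms by (simp add: field_simps)
  \<comment> \<open>As \<eta> runs from \<mu> to L, the numerator falls from L - \<mu> to -(L -
    \<mu>).\<close>
  moreover have "\<bar>(\<mu> + L - 2 * \<eta>) / (L + \<mu>)\<bar> \<le> (L - \<mu>) / (L + \<mu>)"
    using assms \<eta>(1) by (auto simp: abs_divide intro!: divide_right_mono)
  ultimately show "worst_radius \<mu> L (-2 / (\<mu> + L), 1, -2 / (\<mu> + L)) \<le> (L - \<mu>) / (L + \<mu>)"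
    using \<eta>(2) by simp
qed (rule worst_radius_lower_bound[OF assms])

text \<open>The product rule yields two bilinear terms; symmetry of A makes them equal, which
  cancels the factor 1/2.\<close>

lemma GDERIV_quadratic:
  fixes A :: "real^'n^'n"
  assumes "transpose A = A"
  shows "GDERIV (quadratic A b) x :> A *v x + b"
proof -
  have sym: "x \<bullet> (A *v h) = h \<bullet> (A *v x)" for h
    by (metis assms dot_lmul_matrix inner_commute vector_transpose_matrix)
  have "((*v) A has_derivative (*v) A) (at x)"
    by (intro bounded_linear_imp_has_derivative matrix_vector_mul_bounded_linear)
  then have "((\<lambda>x. 1 / 2 * (x \<bullet> (A *v x)) + b \<bullet> x) has_derivative
      (\<lambda>h. 1 / 2 * (x \<bullet> (A *v h) + h \<bullet> (A *v x)) + b \<bullet> h)) (at x)"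
    by (auto intro!: derivative_eq_intros)
  then show ?thesis
    unfolding gderiv_def quadratic_def[abs_def] by (simp add: sym inner_add_right inner_commute[of b])
qed

text \<open>\<open>gradient_descent\<close> only asserts that some gradient exists at each iterate.
  Uniqueness pins that witness down and turns the definition into an explicit recurrence.\<close>

lemma GDERIV_unique:
  assumes "GDERIV f x :> g" "GDERIV f x :> h"
  shows "g = h"
proof -
  have "(\<lambda>y. y \<bullet> g) = (\<lambda>y. y \<bullet> h)"
    using assms unfolding gderiv_def by (rule has_derivative_unique)
  then show ?thesis
    using vector_eq_ldot[of g h] by (simp only: fun_eq_iff)
qed

lemma gradient_descent_quadratic_iff:
  fixes A :: "real^'n^'n"
  assumes "transpose A = A"
  shows "gradient_descent \<beta> (quadratic A b) x \<longleftrightarrow> (\<forall>k. x (Suc k) = x k - \<beta> *\<^sub>R (A *v x k + b))"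
proof -
  have "GDERIV (quadratic A b) (x k) :> g \<longleftrightarrow> g = A *v x k + b" for k g
    using GDERIV_quadratic[OF assms, of b "x k"] GDERIV_unique[of _ "x k" g] by blast
  then show ?thesis
    by (simp add: gradient_descent_def)
qed

lemma scli_iteration_iff:
  "scli_iteration (\<nu>, 1, \<nu>) A b x \<longleftrightarrow> (\<forall>k. x (Suc k) = (mat 1 + \<nu> *\<^sub>R A) *v x k + \<nu> *\<^sub>R b)"
  by (simp add: scli_iteration_def add.commute)

lemma root_radius_ell_less_1:
  assumes "0 < \<mu>" "\<nu> \<in> {-2 / L<..<0}" "\<eta> \<in> {\<mu>..L}"
  shows "root_radius (ell \<nu> 1 \<eta>) < 1"
proof -
  have "-2 < L * \<nu>"
    using assms by (simp add: field_simps)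
  \<comment> \<open>Since \<nu> is negative, \<eta> * \<nu> is smallest at \<eta> = L. Together with
    its negativity this puts \<eta> * \<nu> + 1 strictly between -1 and 1.\<close>
  also have "L * \<nu> \<le> \<eta> * \<nu>"
    using assms by (intro mult_right_mono_neg) auto
  finally have "-2 < \<eta> * \<nu>" .
  moreover have "\<eta> * \<nu> < 0"
    using assms by (intro mult_pos_neg) auto
  ultimately show ?thesis
    by (simp add: root_radius_ell)
qed

theorem mainTheorem6:
  fixes \<mu> L \<kappa> :: real
  assumes "0 < \<mu>" and "\<mu> < L" and "\<kappa> = L / \<mu>"
  defines "admissible \<equiv> {(a0, b0, \<nu>). \<nu> \<in> {-2 / L<..<0} \<and> consistent \<mu> L a0 b0 \<nu>}"
    and "\<nu>\<^sub>F \<equiv> -2 / (\<mu> + L)"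
  shows
    "(\<forall>a0 b0 \<nu>. (a0, b0, \<nu>) \<in> admissible \<longrightarrow>
        a0 = \<nu> \<and> b0 = 1 \<and>
        (\<forall>\<eta>\<in>{\<mu>..L}. root_radius (ell a0 b0 \<eta>) < 1) \<and>
        (\<forall>(A :: real^'n^'n) b x. symmetric_spectrum_in A {\<mu>..L} \<longrightarrow>
           (scli_iteration (a0, b0, \<nu>) A b x \<longleftrightarrow>
             (\<forall>k. x (Suc k) = (mat 1 + \<nu> *\<^sub>R A) *v x k + \<nu> *\<^sub>R b))) \<and>
        (\<exists>\<eta>\<in>{\<mu>..L}. root_radius (ell a0 b0 \<eta>) = worst_radius \<mu> L (a0, b0, \<nu>)) \<and>
        (\<forall>\<eta>\<in>{\<mu>..L}. root_radius (ell a0 b0 \<eta>) \<le> worst_radius \<mu> L (a0, b0, \<nu>))) \<and>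
     is_arg_min (worst_radius \<mu> L) (\<lambda>p. p \<in> admissible) (\<nu>\<^sub>F, 1, \<nu>\<^sub>F) \<and>
     worst_radius \<mu> L (\<nu>\<^sub>F, 1, \<nu>\<^sub>F) = (\<kappa> - 1) / (\<kappa> + 1) \<and>
     (\<forall>(A :: real^'n^'n) b x. symmetric_spectrum_in A {\<mu>..L} \<longrightarrow>
        (scli_iteration (\<nu>\<^sub>F, 1, \<nu>\<^sub>F) A b x \<longleftrightarrow> full_gradient_descent \<mu> L (quadratic A b) x)) \<and>
     is_arg_min (worst_radius \<mu> L) (\<lambda>p. p \<in> linear_scli \<mu> L) (\<nu>\<^sub>F, 1, \<nu>\<^sub>F)"
proof -
  note pos = \<open>0 < \<mu>\<close> \<open>\<mu> < L\<close>
  note cons = consistent_iff[OF pos(2)]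
  have \<nu>F: "\<nu>\<^sub>F \<in> {-2 / L<..<0}"
    using pos by (simp add: \<nu>\<^sub>F_def field_simps)
  have wF: "worst_radius \<mu> L (\<nu>\<^sub>F, 1, \<nu>\<^sub>F) = (L - \<mu>) / (L + \<mu>)"
    unfolding \<nu>\<^sub>F_def by (rule worst_radius_full_gradient_descent[OF pos])
  \<comment> \<open>Numerator and denominator are divided by \<mu>.\<close>
  have \<kappa>: "(L - \<mu>) / (L + \<mu>) = (\<kappa> - 1) / (\<kappa> + 1)"
    using pos unfolding \<open>\<kappa> = L / \<mu>\<close> by (simp add: divide_simps)
  have adm: "(a0, b0, \<nu>) \<in> admissible \<longleftrightarrow> \<nu> \<in> {-2 / L<..<0} \<and> a0 = \<nu> \<and> b0 = 1" for a0 b0 \<nu>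
    by (simp add: admissible_def cons)
  \<comment> \<open>Stated for an arbitrary S so as to serve both \<open>admissible\<close> and
    \<open>linear_scli\<close>: on any set of triples of the form (\<nu>, 1, \<nu>) the lower bound
    applies, and \<open>\<nu>\<^sub>F\<close> meets it.\<close>
  have opt: "is_arg_min (worst_radius \<mu> L) (\<lambda>p. p \<in> S) (\<nu>\<^sub>F, 1, \<nu>\<^sub>F)"
    if "(\<nu>\<^sub>F, 1, \<nu>\<^sub>F) \<in> S" "\<And>a0 b0 \<nu>. (a0, b0, \<nu>) \<in> S \<Longrightarrow> a0 = \<nu> \<and> b0 = 1" for S
  proof -
    have "(L - \<mu>) / (L + \<mu>) \<le> worst_radius \<mu> L p" if "p \<in> S" for p
      using that \<open>\<And>a0 b0 \<nu>. (a0, b0, \<nu>) \<in> S \<Longrightarrow> a0 = \<nu> \<and> b0 = 1\<close> worst_radius_lower_bound[OF pos]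
      by (metis prod.exhaust)
    then show ?thesis
      using that(1) by (auto simp: is_arg_min_def wF not_less)
  qed
  have gd: "scli_iteration (\<nu>\<^sub>F, 1, \<nu>\<^sub>F) A b x \<longleftrightarrow> full_gradient_descent \<mu> L (quadratic A b) x"
    if "symmetric_spectrum_in A {\<mu>..L}" for A :: "real^'n^'n" and b x
  proof -
    \<comment> \<open>Both methods apply the same affine map at each step, because
      \<open>\<nu>\<^sub>F\<close> is minus the step size and the gradient at y is
      \<open>A *v y + b\<close>.\<close>
    have "(mat 1 + \<nu>\<^sub>F *\<^sub>R A) *v y + \<nu>\<^sub>F *\<^sub>R b = y - (2 / (\<mu> + L)) *\<^sub>R (A *v y + b)" for y
      by (simp add: \<nu>\<^sub>F_def matrix_vector_mult_diff_rdistrib scaleR_matrix_vector_assoc[symmetric]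
          scaleR_add_right)
    then show ?thesis
      using that unfolding full_gradient_descent_def
      by (simp add: scli_iteration_iff gradient_descent_quadratic_iff symmetric_spectrum_in_def)
  qed
  have "is_arg_min (worst_radius \<mu> L) (\<lambda>p. p \<in> admissible) (\<nu>\<^sub>F, 1, \<nu>\<^sub>F)"
    using \<nu>F by (intro opt) (auto simp: adm)
  \<comment> \<open>Here membership asks for radius below 1 instead of a range for \<nu>; for
    \<open>\<nu>\<^sub>F\<close> this follows from its lying in the range.\<close>
  moreover have "is_arg_min (worst_radius \<mu> L) (\<lambda>p. p \<in> linear_scli \<mu> L) (\<nu>\<^sub>F, 1, \<nu>\<^sub>F)"
    using root_radius_ell_less_1[OF pos(1) \<nu>F] by (intro opt) (auto simp: linear_scli_def cons)
  moreover have "a0 = \<nu> \<and> b0 = 1 \<and>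
        (\<forall>\<eta>\<in>{\<mu>..L}. root_radius (ell a0 b0 \<eta>) < 1) \<and>
        (\<forall>(A :: real^'n^'n) b x. symmetric_spectrum_in A {\<mu>..L} \<longrightarrow>
           (scli_iteration (a0, b0, \<nu>) A b x \<longleftrightarrow>
             (\<forall>k. x (Suc k) = (mat 1 + \<nu> *\<^sub>R A) *v x k + \<nu> *\<^sub>R b))) \<and>
        (\<exists>\<eta>\<in>{\<mu>..L}. root_radius (ell a0 b0 \<eta>) = worst_radius \<mu> L (a0, b0, \<nu>)) \<and>
        (\<forall>\<eta>\<in>{\<mu>..L}. root_radius (ell a0 b0 \<eta>) \<le> worst_radius \<mu> L (a0, b0, \<nu>))"
    if "(a0, b0, \<nu>) \<in> admissible" for a0 b0 \<nu>
  proof -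
    have *: "a0 = \<nu>" "b0 = 1" "\<nu> \<in> {-2 / L<..<0}"
      using that by (simp_all add: adm)
    show ?thesis
      unfolding *(1,2)
      using worst_radius_attained[OF less_imp_le[OF pos(2)], of \<nu> 1 \<nu>]
        root_radius_ell_less_1[OF pos(1) *(3)] scli_iteration_iff by blast
  qed
  ultimately show ?thesis
    using gd unfolding wF \<kappa> by blast
qed

end
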